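(* Let $\mathcal{A}\in T_{m,n}$ and let $P\in\mathbb{R}^{n\times n}$ be a permutation matrix of order $n$. Then $\mathcal{A}$ is a column competent tensor if and only if $P^T\mathcal{A}P$ is a column competent tensor.
   Context: $T_{m,n}$ is the set of real tensors $\mathcal{A}=(a_{i_1 i_2\ldots i_m})$ of order $m$ and dimension $n$ (with $i_1,\ldots,i_m\in[n]=\{1,\ldots,n\}$, $m,n$ positive integers, $m\ge 2$). For $x\in\mathbb{R}^n$, $\mathcal{A}x^{m-1}\in\mathbb{R}^n$ is the vector with $(\mathcal{A}x^{m-1})_i=\sum_{i_2,\ldots,i_m=1}^n a_{i i_2\ldots i_m}x_{i_2}\cdots x_{i_m}$. A tensor $\mathcal{A}\in T_{m,n}$ is column competent if, for $x\in\mathbb{R}^n$, $x_i(\mathcal{A}x^{m-1})_i=0$ for all $i\in[n]$ implies $\mathcal{A}x^{m-1}=0$. For matrices $R=(r_{ij}),Q=(q_{ij})\in\mathbb{R}^{n\times n}$, the product $R\mathcal{A}Q\in T_{m,n}$ (Shao's general tensor product) has entries $(R\mathcal{A}Q)_{i_1 i_2\ldots i_m}=\sum_{j_1,\ldots,j_m\in[n]} r_{i_1j_1}a_{j_1j_2\ldots j_m}q_{j_2i_2}\cdots q_{j_mi_m}$. *)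

theory Defs
  imports "HOL-Analysis.Analysis"
begin

text \<open>
  The index set \<open>[n]\<close> is a finite type \<open>'n\<close>, so that \<open>n = CARD('n)\<close>. A tensor of order \<open>m\<close> maps
  an index tuple \<open>(i\<^sub>1, \<dots>, i\<^sub>m)\<close>, given as a list of length \<open>m\<close>, to its entry; it takes the
  fixed value \<open>undefined\<close> on all other lists, so that a tensor is determined by its entries.
\<close>

definition tensors :: "nat \<Rightarrow> ('n::finite list \<Rightarrow> real) set" where
  "tensors m = extensional {js. length js = m}"

definition tensor_apply :: "nat \<Rightarrow> ('n::finite list \<Rightarrow> real) \<Rightarrow> real ^ 'n \<Rightarrow> real ^ 'n" where
  "tensor_apply m A x =
     (\<chi> i. \<Sum>js | length js = m - 1. A (i # js) * (\<Prod>k<m - 1. x $ (js ! k)))"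

definition column_competent :: "nat \<Rightarrow> ('n::finite list \<Rightarrow> real) \<Rightarrow> bool" where
  "column_competent m A \<longleftrightarrow>
     (\<forall>x :: real ^ 'n. (\<forall>i. x $ i * tensor_apply m A x $ i = 0) \<longrightarrow> tensor_apply m A x = 0)"

text \<open>
  Shao's general product \<open>R A Q\<close>. List positions start at \<open>0\<close>, so position \<open>0\<close> is the first index,
  on which \<open>R\<close> acts, and positions \<open>1, \<dots>, m - 1\<close> are those on which \<open>Q\<close> acts.
\<close>

definition tensor_product ::
    "nat \<Rightarrow> real ^ 'n ^ 'n \<Rightarrow> ('n::finite list \<Rightarrow> real) \<Rightarrow> real ^ 'n ^ 'n \<Rightarrow> 'n list \<Rightarrow> real" where
  "tensor_product m R A Q =
     restrict (\<lambda>ks. \<Sum>js | length js = m.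
         R $ (ks ! 0) $ (js ! 0) * A js * (\<Prod>l=1..<m. Q $ (js ! l) $ (ks ! l)))
       {ks. length ks = m}"

lemma tensor_product_in_tensors: "tensor_product m R A Q \<in> tensors m"
  by (simp add: tensor_product_def tensors_def)

definition permutation_matrix :: "real ^ 'n ^ 'n \<Rightarrow> bool" where
  "permutation_matrix P \<longleftrightarrow>
     (\<forall>i j. P $ i $ j \<in> {0, 1}) \<and> (\<forall>i. \<exists>!j. P $ i $ j = 1) \<and> (\<forall>j. \<exists>!i. P $ i $ j = 1)"

end

theory Submission
  imports Defs
begin

text \<open>
  If \<open>f j\<close> is the row of the entry \<open>1\<close> in column \<open>j\<close> of \<open>P\<close>, then \<open>P\<^sup>T A P\<close> has the entry
  \<open>A (f i\<^sub>1, \<dots>, f i\<^sub>m)\<close> at \<open>(i\<^sub>1, \<dots>, i\<^sub>m)\<close>. Reindexing the sums along the bijection \<open>f\<close> shows that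
  \<open>P\<^sup>T A P\<close> maps \<open>y \<circ> f\<close> to \<open>(A y\<^sup>m\<^sup>-\<^sup>1) \<circ> f\<close>, so column competence is just a relabelling of
  coordinates.
\<close>

lemma permutation_matrix_bijE:
  fixes P :: "real ^ 'n ^ 'n"
  assumes "permutation_matrix P"
  obtains f where "bij f" and "\<And>i j. P $ i $ j = of_bool (i = f j)"
proof -
  have entry: "P $ i $ j = 0 \<or> P $ i $ j = 1" for i j
    using assms by (auto simp: permutation_matrix_def)
  have row: "\<exists>!j. P $ i $ j = 1" and col: "\<exists>!i. P $ i $ j = 1" for i j
    using assms by (auto simp: permutation_matrix_def)
  define f where "f j = (THE i. P $ i $ j = 1)" for j
  have f: "P $ i $ j = 1 \<longleftrightarrow> i = f j" for i j
    unfolding f_def using theI'[OF col[of j]] col[of j] by blast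
  have "bij f"
    \<comment> \<open>By \<open>f\<close>, the unique \<open>1\<close> in row \<open>i\<close> is a
      unique preimage of \<open>i\<close> under \<open>f\<close>.\<close>
    unfolding bij_iff using row f by metis
  moreover have "P $ i $ j = of_bool (i = f j)" for i j
    using entry[of i j] f[of i j] by auto
  ultimately show thesis
    using that by blast
qed

lemma finite_lists_length [simp]: "finite {js :: 'n::finite list. length js = m}"
  using finite_lists_length_eq[of "UNIV :: 'n set" m] by simp

text \<open>The 0/1 entries of \<open>P\<close> multiply to the indicator of
  \<open>js = map f ks\<close>, so a single summand survives.\<close>

lemma tensor_product_permutation:
  fixes A :: "'n::finite list \<Rightarrow> real"
  assumes P: "\<And>i j. P $ i $ j = of_bool (i = f j)" and "m > 0" and ks: "length ks = m"
  shows "tensor_product m (transpose P) A P ks = A (map f ks)"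
proof -
  have "transpose P $ (ks ! 0) $ (js ! 0) * A js * (\<Prod>l=1..<m. P $ (js ! l) $ (ks ! l))
      = (if js = map f ks then A js else 0)" if js: "length js = m" for js
  proof -
    \<comment> \<open>Transposing turns the factor of the first index into the missing factor
      \<open>l = 0\<close> of the product; that position exists since \<open>m > 0\<close>.\<close>
    have "transpose P $ (ks ! 0) $ (js ! 0) * (\<Prod>l=1..<m. P $ (js ! l) $ (ks ! l))
        = (\<Prod>l=0..<m. P $ (js ! l) $ (ks ! l))"
      using \<open>m > 0\<close> by (simp add: prod.atLeast_Suc_lessThan transpose_def)
    also have "\<dots> = of_bool (\<forall>l<m. js ! l = f (ks ! l))"
      by (auto simp: P)
    also have "(\<forall>l<m. js ! l = f (ks ! l)) \<longleftrightarrow> js = map f ks"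
      using js ks by (auto simp: list_eq_iff_nth_eq)
    finally have "A js * (transpose P $ (ks ! 0) $ (js ! 0) * (\<Prod>l=1..<m. P $ (js ! l) $ (ks ! l)))
        = (if js = map f ks then A js else 0)"
      by simp
    then show ?thesis
      by (simp only: mult.assoc mult.commute mult.left_commute)
  qed
  then have "tensor_product m (transpose P) A P ks
      = (\<Sum>js | length js = m. if js = map f ks then A js else 0)"
    using ks by (simp add: tensor_product_def)
  also have "\<dots> = A (map f ks)"
    using ks by (simp add: sum.delta)
  finally show ?thesis .
qed

lemma bij_betw_map_length:
  assumes "bij f"
  shows "bij_betw (map f) {js. length js = m} {js. length js = m}"
  using assms
  by (intro bij_betw_byWitness[where f' = "map (inv f)"])
     (auto simp: o_def bij_is_inj bij_is_surj surj_f_inv_f)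

lemma tensor_apply_relabel:
  fixes A B :: "'n::finite list \<Rightarrow> real"
  assumes "bij f" and "m > 0" and B: "\<And>ks. length ks = m \<Longrightarrow> B ks = A (map f ks)"
  shows "tensor_apply m B (\<chi> i. y $ f i) $ i = tensor_apply m A y $ f i"
proof -
  have "tensor_apply m B (\<chi> i. y $ f i) $ i
      = (\<Sum>js | length js = m - 1. A (f i # map f js) * (\<Prod>k<m - 1. y $ (map f js ! k)))"
    \<comment> \<open>As \<open>m > 0\<close>, \<open>i # js\<close> has length exactly
      \<open>m\<close>, so \<open>B\<close> applies to it.\<close>
    using \<open>m > 0\<close> by (auto simp: tensor_apply_def B intro!: sum.cong prod.cong)
  also have "\<dots> = (\<Sum>js | length js = m - 1. A (f i # js) * (\<Prod>k<m - 1. y $ (js ! k)))"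
    using bij_betw_map_length[OF \<open>bij f\<close>] by (rule sum.reindex_bij_betw)
  finally show ?thesis
    by (simp add: tensor_apply_def)
qed

lemma column_competent_relabel:
  fixes A B :: "'n::finite list \<Rightarrow> real"
  assumes "bij f" and "m > 0" and "\<And>ks. length ks = m \<Longrightarrow> B ks = A (map f ks)"
  shows "column_competent m A \<longleftrightarrow> column_competent m B"
proof -
  define r :: "real ^ 'n \<Rightarrow> real ^ 'n" where "r y = (\<chi> i. y $ f i)" for y
  have all_f: "(\<forall>i. Q (f i)) \<longleftrightarrow> (\<forall>i. Q i)" for Q
    using \<open>bij f\<close> by (metis bij_pointE)
  \<comment> \<open>Relabelling by \<open>inv f\<close> is a right inverse of \<open>r\<close>, so
    every vector has the form \<open>r y\<close>.\<close>
  have "r (\<chi> j. x $ inv f j) = x" for x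
    using \<open>bij f\<close> by (simp add: r_def vec_eq_iff bij_is_inj)
  then have "surj r"
    by (rule surjI)
  then have all_r: "(\<forall>x. Q x) \<longleftrightarrow> (\<forall>y. Q (r y))" for Q
    by (metis surjD)
  have apply_r: "tensor_apply m B (r y) $ i = tensor_apply m A y $ f i" for y i
    unfolding r_def using assms by (rule tensor_apply_relabel)
  have nth_r: "r y $ i = y $ f i" for y i
    by (simp add: r_def)
  \<comment> \<open>The instance of \<open>all_r\<close> mentions \<open>B\<close>, so only the
    vectors tested against \<open>B\<close> are replaced by \<open>r y\<close>. Then
    \<open>apply_r\<close> and \<open>nth_r\<close> express everything through \<open>A\<close> at
    coordinates \<open>f i\<close>, and \<open>all_f\<close> removes \<open>f\<close>, making both
    sides identical.\<close>
  show ?thesis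
    unfolding column_competent_def all_r[of "\<lambda>x. (\<forall>i. x $ i * tensor_apply m B x $ i = 0) \<longrightarrow> _ x"]
      vec_eq_iff apply_r nth_r zero_index
      all_f[of "\<lambda>i. _ $ i * tensor_apply m A _ $ i = 0"] all_f[of "\<lambda>i. tensor_apply m A _ $ i = 0"]
    by (rule refl)
qed

theorem theorem3p3:
  fixes m :: nat
    and A :: "'n::finite list \<Rightarrow> real"
    and P :: "real ^ 'n ^ 'n"
  assumes "m \<ge> 2"
    and "A \<in> tensors m"
    and "permutation_matrix P"
  shows "column_competent m A \<longleftrightarrow> column_competent m (tensor_product m (transpose P) A P)"
proof -
  have "m > 0"
    using \<open>m \<ge> 2\<close> by simp
  obtain f where "bij f" and P: "\<And>i j. P $ i $ j = of_bool (i = f j)"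
    using permutation_matrix_bijE[OF \<open>permutation_matrix P\<close>] by blast
  show ?thesis
    using \<open>bij f\<close> \<open>m > 0\<close> tensor_product_permutation[OF P \<open>m > 0\<close>]
    by (rule column_competent_relabel)
qed

end
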